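(* Let $S$ be a multiplicatively closed subset of a ring $R$ and $N$ a submodule of an $R$-module $M$ such that $(N:_{R}M)\cap S=\emptyset$. If $(N:_{M}s)$ is a weakly prime submodule of $M$ for some $s\in S$, then $N$ is a weakly $S$-prime submodule of $M$. Conversely, if $N$ is non-zero, $S\cap Z(M)=\emptyset$, and $N$ is a weakly $S$-prime submodule of $M$, then $(N:_{M}s)$ is a weakly prime submodule of $M$ for some $s\in S$.
   Context: Rings are commutative with non-zero identity and modules are unital. A non-empty subset $S$ of $R$ is multiplicatively closed if it is closed under multiplication. $(N:_{R}M)=\{r\in R: rM\subseteq N\}$, $(N:_{M}s)=\{m\in M: sm\in N\}$, and $Z(M)=\{r\in R: rm=0\text{ for some } m\in M\setminus\{0_{M}\}\}$. A proper submodule $N$ of $M$ is weakly prime if for all $r\in R$, $m\in M$ with $0\neq rm\in N$, either $r\in(N:_{R}M)$ or $m\in N$. A submodule $N$ of $M$ with $(N:_{R}M)\cap S=\emptyset$ is weakly $S$-prime if there exists a fixed $s\in S$ such that for all $a\in R$, $m\in M$ with $0\neq am\in N$, either $sa\in(N:_{R}M)$ or $sm\in N$. *)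

theory Defs
  imports "HOL-Algebra.Module"
begin

text \<open>A multiplicatively closed set is not required to contain the identity, so this is weaker
  than \<^const>\<open>submonoid\<close>.\<close>

definition mult_closed_subset :: "'a set \<Rightarrow> ('a, 'r) ring_scheme \<Rightarrow> bool" where
  "mult_closed_subset S R \<longleftrightarrow>
     S \<subseteq> carrier R \<and> S \<noteq> {} \<and> (\<forall>a\<in>S. \<forall>b\<in>S. a \<otimes>\<^bsub>R\<^esub> b \<in> S)"

text \<open>$(N :_R M)$\<close>

definition residual_ideal ::
    "('a, 'r) ring_scheme \<Rightarrow> ('a, 'b, 'm) module_scheme \<Rightarrow> 'b set \<Rightarrow> 'a set" where
  "residual_ideal R M N = {r \<in> carrier R. \<forall>m\<in>carrier M. r \<odot>\<^bsub>M\<^esub> m \<in> N}"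

text \<open>$(N :_M s)$\<close>

definition residual_submodule :: "('a, 'b, 'm) module_scheme \<Rightarrow> 'b set \<Rightarrow> 'a \<Rightarrow> 'b set" where
  "residual_submodule M N s = {m \<in> carrier M. s \<odot>\<^bsub>M\<^esub> m \<in> N}"

text \<open>$Z(M)$\<close>

definition module_zero_divisors ::
    "('a, 'r) ring_scheme \<Rightarrow> ('a, 'b, 'm) module_scheme \<Rightarrow> 'a set" where
  "module_zero_divisors R M =
     {r \<in> carrier R. \<exists>m \<in> carrier M - {\<zero>\<^bsub>M\<^esub>}. r \<odot>\<^bsub>M\<^esub> m = \<zero>\<^bsub>M\<^esub>}"

definition weakly_prime_submodule ::
    "'b set \<Rightarrow> ('a, 'r) ring_scheme \<Rightarrow> ('a, 'b, 'm) module_scheme \<Rightarrow> bool" where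
  "weakly_prime_submodule N R M \<longleftrightarrow>
     submodule N R M \<and> N \<noteq> carrier M \<and>
     (\<forall>r \<in> carrier R. \<forall>m \<in> carrier M.
        r \<odot>\<^bsub>M\<^esub> m \<noteq> \<zero>\<^bsub>M\<^esub> \<longrightarrow> r \<odot>\<^bsub>M\<^esub> m \<in> N \<longrightarrow>
        r \<in> residual_ideal R M N \<or> m \<in> N)"

definition weakly_S_prime_submodule ::
    "'a set \<Rightarrow> 'b set \<Rightarrow> ('a, 'r) ring_scheme \<Rightarrow> ('a, 'b, 'm) module_scheme \<Rightarrow> bool" where
  "weakly_S_prime_submodule S N R M \<longleftrightarrow>
     submodule N R M \<and> residual_ideal R M N \<inter> S = {} \<and>
     (\<exists>s\<in>S. \<forall>a \<in> carrier R. \<forall>m \<in> carrier M.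
        a \<odot>\<^bsub>M\<^esub> m \<noteq> \<zero>\<^bsub>M\<^esub> \<longrightarrow> a \<odot>\<^bsub>M\<^esub> m \<in> N \<longrightarrow>
        s \<otimes>\<^bsub>R\<^esub> a \<in> residual_ideal R M N \<or> s \<odot>\<^bsub>M\<^esub> m \<in> N)"

end

theory Submission
  imports Defs
begin

text \<open>
  Write $P = (N :_M s)$. Everything rests on the fact that
  $r \in (P :_R M)$ iff $sr \in (N :_R M)$: the two alternatives in the definition of
  weak $S$-primeness of $N$ with witness $s$ are then literally the two alternatives in the
  definition of weak primeness of $P$. Since $N \subseteq P$, this at once gives the first
  implication.

  For the second implication, take a witness $s$ for $N$ and let $0 \neq rm \in P$. As $s$ kills
  no non-zero element of $M$, the element $r(sm) = s(rm)$ of $N$ is non-zero, so either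
  $sr \in (N :_R M)$, as wanted, or only $s(sm) \in N$, one factor $s$ too many. The extra factor
  is removed by applying the hypothesis again, to the scalar $s^2$ and the element $m$: the
  alternative $s^3 \in (N :_R M)$ is impossible because $s^3 \in S$.
\<close>

lemma mem_residual_ideal_residual_submodule_iff:
  assumes "module R M" "s \<in> carrier R" "r \<in> carrier R"
  shows "r \<in> residual_ideal R M (residual_submodule M N s)
           \<longleftrightarrow> s \<otimes>\<^bsub>R\<^esub> r \<in> residual_ideal R M N"
proof -
  interpret module R M by fact
  show ?thesis
    using assms(2,3) by (auto simp: residual_ideal_def residual_submodule_def smult_assoc1)
qed

lemma submodule_subset_residual_submodule:
  assumes "module R M" "submodule N R M" "s \<in> carrier R"
  shows "N \<subseteq> residual_submodule M N s"
proof -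
  interpret module R M by fact
  interpret submodule N R M by fact
  show ?thesis
    using assms(3) subset smult_closed by (auto simp: residual_submodule_def)
qed

lemma submodule_residual_submodule:
  assumes "module R M" "submodule N R M" "s \<in> carrier R"
  shows "submodule (residual_submodule M N s) R M"
proof -
  interpret module R M by fact
  note N = submoduleE[OF assms(2)]
  show ?thesis
  proof (rule submoduleI)
    show "residual_submodule M N s \<subseteq> carrier M"
      by (auto simp: residual_submodule_def)
    have "\<zero>\<^bsub>M\<^esub> \<in> N"
      using subgroup.one_closed[OF submodule.axioms(1)[OF assms(2)]] by simp
    then show "\<zero>\<^bsub>M\<^esub> \<in> residual_submodule M N s"
      using assms(3) by (simp add: residual_submodule_def)
  next
    fix a assume "a \<in> residual_submodule M N s"
    then show "\<ominus>\<^bsub>M\<^esub> a \<in> residual_submodule M N s"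
      using assms(3) N(3) by (simp add: residual_submodule_def smult_r_minus)
  next
    fix a b assume "a \<in> residual_submodule M N s" "b \<in> residual_submodule M N s"
    then show "a \<oplus>\<^bsub>M\<^esub> b \<in> residual_submodule M N s"
      using assms(3) N(5) by (simp add: residual_submodule_def smult_r_distr)
  next
    fix a x assume "a \<in> carrier R" "x \<in> residual_submodule M N s"
    moreover from this have "s \<odot>\<^bsub>M\<^esub> (a \<odot>\<^bsub>M\<^esub> x) = a \<odot>\<^bsub>M\<^esub> (s \<odot>\<^bsub>M\<^esub> x)"
      using assms(3) by (simp add: residual_submodule_def R.m_comm flip: smult_assoc1)
    ultimately show "a \<odot>\<^bsub>M\<^esub> x \<in> residual_submodule M N s"
      using N(4) by (simp add: residual_submodule_def)
  qed
qed

lemma weakly_S_prime_if_residual_weakly_prime: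
  assumes "module R M" "S \<subseteq> carrier R" "submodule N R M" "residual_ideal R M N \<inter> S = {}"
    and "s \<in> S" "weakly_prime_submodule (residual_submodule M N s) R M"
  shows "weakly_S_prime_submodule S N R M"
  unfolding weakly_S_prime_submodule_def
proof (intro conjI bexI[of _ s] ballI impI)
  fix a m
  assume a: "a \<in> carrier R" and m: "m \<in> carrier M"
    and "a \<odot>\<^bsub>M\<^esub> m \<noteq> \<zero>\<^bsub>M\<^esub>" "a \<odot>\<^bsub>M\<^esub> m \<in> N"
  have s: "s \<in> carrier R"
    using assms(2,5) by blast
  have "a \<odot>\<^bsub>M\<^esub> m \<in> residual_submodule M N s"
    using submodule_subset_residual_submodule[OF assms(1,3) s] \<open>a \<odot>\<^bsub>M\<^esub> m \<in> N\<close> by blast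
  then have "a \<in> residual_ideal R M (residual_submodule M N s) \<or> m \<in> residual_submodule M N s"
    using assms(6) a m \<open>a \<odot>\<^bsub>M\<^esub> m \<noteq> \<zero>\<^bsub>M\<^esub>\<close> by (simp add: weakly_prime_submodule_def)
  then show "s \<otimes>\<^bsub>R\<^esub> a \<in> residual_ideal R M N \<or> s \<odot>\<^bsub>M\<^esub> m \<in> N"
    unfolding mem_residual_ideal_residual_submodule_iff[OF assms(1) s a]
    by (auto simp: residual_submodule_def)
qed (use assms in auto)

text \<open>Any witness $s$ of weak $S$-primeness serves: it is used once on $r$ and $sm$, and a second
  time on $s^2$ and $m$ to cancel the surplus factor $s$. That $S$ avoids the zero divisors keeps
  both products non-zero, as weak primeness demands before it says anything.\<close>

lemma residual_weakly_prime_if_weakly_S_prime: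
  assumes "module R M" "mult_closed_subset S R" "S \<inter> module_zero_divisors R M = {}"
    and "weakly_S_prime_submodule S N R M"
  shows "\<exists>s\<in>S. weakly_prime_submodule (residual_submodule M N s) R M"
proof -
  interpret module R M by fact
  have N: "submodule N R M" and disj: "residual_ideal R M N \<inter> S = {}"
    using assms(4) by (simp_all add: weakly_S_prime_submodule_def)
  obtain s where "s \<in> S"
    and witness: "\<And>a m. \<lbrakk>a \<in> carrier R; m \<in> carrier M; a \<odot>\<^bsub>M\<^esub> m \<noteq> \<zero>\<^bsub>M\<^esub>; a \<odot>\<^bsub>M\<^esub> m \<in> N\<rbrakk>
      \<Longrightarrow> s \<otimes>\<^bsub>R\<^esub> a \<in> residual_ideal R M N \<or> s \<odot>\<^bsub>M\<^esub> m \<in> N"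
    using assms(4) unfolding weakly_S_prime_submodule_def by blast
  have s: "s \<in> carrier R" and cube: "s \<otimes>\<^bsub>R\<^esub> (s \<otimes>\<^bsub>R\<^esub> s) \<in> S"
    using assms(2) \<open>s \<in> S\<close> by (auto simp: mult_closed_subset_def)
  have regular: "s \<odot>\<^bsub>M\<^esub> m \<noteq> \<zero>\<^bsub>M\<^esub>" if "m \<in> carrier M" "m \<noteq> \<zero>\<^bsub>M\<^esub>" for m
    using assms(3) \<open>s \<in> S\<close> s that by (auto simp: module_zero_divisors_def)
  let ?P = "residual_submodule M N s"
  have "?P \<noteq> carrier M"
    using disj \<open>s \<in> S\<close> s by (auto simp: residual_ideal_def residual_submodule_def)
  moreover have "r \<in> residual_ideal R M ?P \<or> m \<in> ?P"
    if r: "r \<in> carrier R" and m: "m \<in> carrier M"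
      and nz: "r \<odot>\<^bsub>M\<^esub> m \<noteq> \<zero>\<^bsub>M\<^esub>" and rm: "r \<odot>\<^bsub>M\<^esub> m \<in> ?P" for r m
  proof -
    have swap: "r \<odot>\<^bsub>M\<^esub> (s \<odot>\<^bsub>M\<^esub> m) = s \<odot>\<^bsub>M\<^esub> (r \<odot>\<^bsub>M\<^esub> m)"
      using r s m by (simp add: R.m_comm flip: smult_assoc1)
    have "s \<otimes>\<^bsub>R\<^esub> r \<in> residual_ideal R M N \<or> s \<odot>\<^bsub>M\<^esub> (s \<odot>\<^bsub>M\<^esub> m) \<in> N"
      using witness[of r "s \<odot>\<^bsub>M\<^esub> m"] regular[of "r \<odot>\<^bsub>M\<^esub> m"] r s m nz rm
      by (simp add: swap residual_submodule_def)
    \<comment> \<open>cancelling one factor $s$ modulo $N$\<close>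
    moreover have "s \<odot>\<^bsub>M\<^esub> m \<in> N" if "s \<odot>\<^bsub>M\<^esub> (s \<odot>\<^bsub>M\<^esub> m) \<in> N"
    proof -
      have "m \<noteq> \<zero>\<^bsub>M\<^esub>"
        using nz r by auto
      then have "s \<odot>\<^bsub>M\<^esub> (s \<odot>\<^bsub>M\<^esub> m) \<noteq> \<zero>\<^bsub>M\<^esub>"
        using regular s m by simp
      then have "s \<otimes>\<^bsub>R\<^esub> (s \<otimes>\<^bsub>R\<^esub> s) \<in> residual_ideal R M N \<or> s \<odot>\<^bsub>M\<^esub> m \<in> N"
        using witness[of "s \<otimes>\<^bsub>R\<^esub> s" m] s m that by (simp add: smult_assoc1)
      then show ?thesis
        using disj cube by blast
    qed
    ultimately show ?thesis
      unfolding mem_residual_ideal_residual_submodule_iff[OF assms(1) s r]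
      using m by (auto simp: residual_submodule_def)
  qed
  ultimately have "weakly_prime_submodule ?P R M"
    using submodule_residual_submodule[OF assms(1) N s]
    unfolding weakly_prime_submodule_def by blast
  then show ?thesis
    using \<open>s \<in> S\<close> by blast
qed

theorem proposition2:
  fixes R :: "('a, 'r) ring_scheme" and M :: "('a, 'b, 'm) module_scheme"
    and S :: "'a set" and N :: "'b set"
  assumes "module R M"
    and "\<one>\<^bsub>R\<^esub> \<noteq> \<zero>\<^bsub>R\<^esub>"
    and "mult_closed_subset S R"
    and "submodule N R M"
    and "residual_ideal R M N \<inter> S = {}"
  shows "((\<exists>s\<in>S. weakly_prime_submodule (residual_submodule M N s) R M)
            \<longrightarrow> weakly_S_prime_submodule S N R M) \<and>
         (N \<noteq> {\<zero>\<^bsub>M\<^esub>} \<and> S \<inter> module_zero_divisors R M = {} \<and> weakly_S_prime_submodule S N R M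
            \<longrightarrow> (\<exists>s\<in>S. weakly_prime_submodule (residual_submodule M N s) R M))"
proof -
  have "S \<subseteq> carrier R"
    using assms(3) by (simp add: mult_closed_subset_def)
  then show ?thesis
    using weakly_S_prime_if_residual_weakly_prime[OF assms(1) _ assms(4,5)]
      residual_weakly_prime_if_weakly_S_prime[OF assms(1,3)]
    by blast
qed

end
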